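(* Let $f\in B(I)$ and let $g=f_x$ be its associated function. Assume that $$P(Z_n(x)>0)\to p(x),\qquad P(Z_n(x)<0)\to q(x),\qquad n\to\infty,$$ where $p(x)+q(x)=1$ and $p(x)\neq 1/2$. Then, for every $n\in\mathbb{N}$, $$|L_n(f,x)-(f(x+)p(x)+f(x-)q(x))|\leq |f(x+)-f(x)|\,|P(Z_n(x)>0)-p(x)|+|f(x-)-f(x)|\,|P(Z_n(x)<0)-q(x)|+C_n(\beta)\,\mathbb{E}\,\omega\left(g,\frac{X_{\beta}}{\sqrt{n}}\right).$$
   Context: $\mathbb{N}$ is the set of positive integers, $I$ is a real interval, and $x$ is a fixed point of the interior of $I$. $B(I)$ is the set of all measurable bounded functions $f:I\to\mathbb{R}$ whose right and left limits at $x$, denoted $f(x+)$ and $f(x-)$, exist and are finite. For $f\in B(I)$, its associated function $g=f_x$ is $$f_x(y)=(f(y)-f(x+))1_{I\cap(x,\infty)}(y)+(f(y)-f(x-))1_{I\cap(-\infty,x)}(y),\quad y\in I,$$ where $1_A$ is the indicator function of $A$; in particular $g(x)=0$. The local first modulus of continuity of $g$ at $x$ is $$\omega(g,\theta)=\sup\{|g(x+u)-g(x)|:\ x+u\in I,\ |u|\leq\theta\},\quad \theta\geq 0.$$ For each $n\in\mathbb{N}$, $Z_n(x)$ is a real random variable such that $x+Z_n(x)/\sqrt{n}$ takes values in $I$, and the positive linear operator $L_n$ is given by $$L_n(f,x)=\mathbb{E}\, f\left(x+\frac{Z_n(x)}{\sqrt{n}}\right)$$ for measurable $f:I\to\mathbb{R}$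 for which the expectation is finite. Standing assumption: there are positive constants $\beta$ and $C_n(\beta)$ (possibly depending on $x$) such that for all $n\in\mathbb{N}$ $$P(|Z_n(x)|\geq\theta)\leq C_n(\beta)\exp(-\beta\theta),\quad \theta\geq 0.$$ $X_\beta$ is a random variable with the exponential distribution of parameter $\beta$, i.e. $P(X_\beta\leq y)=1-\exp(-\beta y)$ for $y\geq 0$. *)

theory Defs
  imports "HOL-Probability.Probability"
begin

text \<open>
  A function from I to the reals is represented by a total function of which only the values on I
  matter. The point x is always taken in the interior of the interval I, so the filters
  \<^term>\<open>at_right x\<close> and \<^term>\<open>at_left x\<close> only see values on I, and the limits below are the
  one-sided limits of the function on I.
\<close>

definition right_limit :: "(real \<Rightarrow> real) \<Rightarrow> real \<Rightarrow> real" where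
  "right_limit f x = Lim (at_right x) f"

definition left_limit :: "(real \<Rightarrow> real) \<Rightarrow> real \<Rightarrow> real" where
  "left_limit f x = Lim (at_left x) f"

definition B_space :: "real set \<Rightarrow> real \<Rightarrow> (real \<Rightarrow> real) set" where
  "B_space I x = {f. f \<in> borel_measurable (restrict_space borel I) \<and> bounded (f ` I) \<and>
     (\<exists>l. (f \<longlongrightarrow> l) (at_right x)) \<and> (\<exists>l. (f \<longlongrightarrow> l) (at_left x))}"

definition assoc_fun :: "real set \<Rightarrow> (real \<Rightarrow> real) \<Rightarrow> real \<Rightarrow> real \<Rightarrow> real" where
  "assoc_fun I f x y =
     (f y - right_limit f x) * indicator (I \<inter> {x<..}) y +
     (f y - left_limit f x) * indicator (I \<inter> {..<x}) y"

text \<open>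
  Only meaningful for \<open>\<theta> \<ge> 0\<close> and \<open>g\<close> bounded on I, when the set is nonempty and bounded above.
\<close>

definition local_modulus :: "real set \<Rightarrow> real \<Rightarrow> (real \<Rightarrow> real) \<Rightarrow> real \<Rightarrow> real" where
  "local_modulus I x g \<theta> = Sup {\<bar>g (x + u) - g x\<bar> | u. x + u \<in> I \<and> \<bar>u\<bar> \<le> \<theta>}"

text \<open>
  The variables \<open>Z n\<close> may live on different probability spaces \<open>M n\<close>; they are taken at the
  fixed point x.
\<close>

definition L_op ::
  "(nat \<Rightarrow> 'a measure) \<Rightarrow> (nat \<Rightarrow> 'a \<Rightarrow> real) \<Rightarrow> nat \<Rightarrow> (real \<Rightarrow> real) \<Rightarrow> real \<Rightarrow> real" where
  "L_op M Z n f x = (\<integral>\<omega>. f (x + Z n \<omega> / sqrt (real n)) \<partial>M n)"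

end

theory Submission
  imports Defs
begin

text \<open>
  On \<open>I\<close> the function \<open>f\<close> is its associated function \<open>g\<close> plus a step function with the values
  \<open>f(x+)\<close>, \<open>f(x)\<close> and \<open>f(x-)\<close> to the right of, at and to the left of \<open>x\<close>. The expectation of the
  step function is explicit in \<open>P(Z\<^sub>n > 0)\<close> and \<open>P(Z\<^sub>n < 0)\<close>; because \<open>p + q = 1\<close>, subtracting the
  limit \<open>f(x+) p + f(x-) q\<close> makes the terms with \<open>f(x)\<close> regroup into the two jump terms of the
  bound.

  It remains to bound \<open>E g(x + Z\<^sub>n / \<surd>n)\<close>. Since \<open>g(x) = 0\<close>, the integrand is at most
  \<open>\<omega>(g, \<bar>Z\<^sub>n\<bar> / \<surd>n)\<close> in absolute value. The modulus is nondecreasing, and the exponential tail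
  assumption says that \<open>P(\<bar>Z\<^sub>n\<bar> \<ge> a) \<le> C\<^sub>n P(X\<^sub>\<beta> > a)\<close> for every \<open>a \<ge> 0\<close>. Writing the expectation of
  a nonnegative variable as the integral of its tail turns such a tail comparison into
  \<open>E h(\<bar>Z\<^sub>n\<bar>) \<le> C\<^sub>n E h(X\<^sub>\<beta>)\<close> for every bounded, nonnegative and nondecreasing \<open>h\<close>
  (lemma \<open>integral_mono_le_of_tail_le\<close>), which is applied to \<open>h = \<omega>(g, \<cdot> / \<surd>n)\<close>.
\<close>

section \<open>Comparing expectations through tails\<close>

text \<open>
  By Tonelli: \<open>F\<close> is the length of \<open>[0, F)\<close>.
\<close>

lemma nn_integral_eq_integral_tail:
  fixes F :: "'a \<Rightarrow> real"
  assumes "sigma_finite_measure M"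
    and [measurable]: "F \<in> borel_measurable M" and nonneg: "\<And>\<omega>. \<omega> \<in> space M \<Longrightarrow> 0 \<le> F \<omega>"
  shows "(\<integral>\<^sup>+ \<omega>. ennreal (F \<omega>) \<partial>M) =
    (\<integral>\<^sup>+ t. indicator {0..} t * emeasure M {\<omega> \<in> space M. t < F \<omega>} \<partial>lborel)"
proof -
  interpret M: sigma_finite_measure M by fact
  interpret pair_sigma_finite M lborel ..
  let ?ind = "\<lambda>\<omega> t. indicator {(t, s). 0 \<le> t \<and> t < s} (t, F \<omega>) :: ennreal"
  have "(\<integral>\<^sup>+ \<omega>. ennreal (F \<omega>) \<partial>M) = (\<integral>\<^sup>+ \<omega>. (\<integral>\<^sup>+ t. ?ind \<omega> t \<partial>lborel) \<partial>M)"
  proof (rule nn_integral_cong)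
    fix \<omega> assume "\<omega> \<in> space M"
    have "(\<integral>\<^sup>+ t. ?ind \<omega> t \<partial>lborel) = (\<integral>\<^sup>+ t. indicator {0..<F \<omega>} t \<partial>lborel)"
      by (intro nn_integral_cong) (auto simp: indicator_def)
    also have "\<dots> = ennreal (F \<omega>)"
      using nonneg[OF \<open>\<omega> \<in> space M\<close>] by simp
    finally show "ennreal (F \<omega>) = (\<integral>\<^sup>+ t. ?ind \<omega> t \<partial>lborel)" ..
  qed
  also have "\<dots> = (\<integral>\<^sup>+ t. (\<integral>\<^sup>+ \<omega>. ?ind \<omega> t \<partial>M) \<partial>lborel)"
    by (rule Fubini'[symmetric]) simp
  also have "\<dots> = (\<integral>\<^sup>+ t. indicator {0..} t * emeasure M {\<omega> \<in> space M. t < F \<omega>} \<partial>lborel)"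
  proof (rule nn_integral_cong)
    fix t :: real
    have "(\<integral>\<^sup>+ \<omega>. ?ind \<omega> t \<partial>M) =
        (\<integral>\<^sup>+ \<omega>. indicator {0..} t * indicator {\<omega> \<in> space M. t < F \<omega>} \<omega> \<partial>M)"
      by (intro nn_integral_cong) (auto simp: indicator_def)
    then show "(\<integral>\<^sup>+ \<omega>. ?ind \<omega> t \<partial>M) = indicator {0..} t * emeasure M {\<omega> \<in> space M. t < F \<omega>}"
      by (simp add: nn_integral_cmult)
  qed
  finally show ?thesis .
qed

text \<open>
  A superlevel set of a nondecreasing \<open>h\<close> meets \<open>[0, \<infinity>)\<close>, if at all, in a half-line that starts
  at some \<open>a\<close> and may or may not contain \<open>a\<close>. The weak inequality in the tail of \<open>Y\<close> and the strict one in the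
  tail of \<open>X\<close> cover both possibilities.
\<close>

lemma integral_mono_le_of_tail_le:
  fixes h :: "real \<Rightarrow> real" and Y :: "'a \<Rightarrow> real" and X :: "'b \<Rightarrow> real"
  assumes "prob_space M" "prob_space N"
    and [measurable]: "Y \<in> borel_measurable M" "X \<in> borel_measurable N"
    and Y_nonneg: "\<And>\<omega>. \<omega> \<in> space M \<Longrightarrow> 0 \<le> Y \<omega>"
    and h_mono: "mono h" and h_nonneg: "\<And>s. 0 \<le> h s" and h_bound: "\<And>s. h s \<le> B"
    and C: "0 \<le> C"
    and tail: "\<And>a. 0 \<le> a \<Longrightarrow>
      measure M {\<omega> \<in> space M. a \<le> Y \<omega>} \<le> C * measure N {\<omega> \<in> space N. a < X \<omega>}"
  shows "(\<integral>\<omega>. h (Y \<omega>) \<partial>M) \<le> C * (\<integral>\<omega>. h (X \<omega>) \<partial>N)"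
proof -
  interpret M: prob_space M by fact
  interpret N: prob_space N by fact
  have [measurable]: "h \<in> borel_measurable borel"
    using h_mono by (rule borel_measurable_mono)
  have superlevel: "emeasure M {\<omega> \<in> space M. t < h (Y \<omega>)}
      \<le> ennreal C * emeasure N {\<omega> \<in> space N. t < h (X \<omega>)}" for t
  proof (cases "\<exists>s\<ge>0. t < h s")
    case False
    then have "{\<omega> \<in> space M. t < h (Y \<omega>)} = {}"
      using Y_nonneg by auto
    then show ?thesis by (simp only: emeasure_empty zero_le)
  next
    case True
    define S where "S = {s. 0 \<le> s \<and> t < h s}"
    define a where "a = Inf S"
    have S: "S \<noteq> {}" "bdd_below S"
      using True by (auto simp: S_def intro!: bdd_belowI[of _ 0])
    have "0 \<le> a"
      unfolding a_def using S by (intro cInf_greatest) (auto simp: S_def)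
    have above: "t < h s" if "a < s" for s
    proof -
      obtain r where "r \<in> S" "r < s"
        using S \<open>a < s\<close> unfolding a_def by (auto simp: cInf_less_iff)
      then show ?thesis
        using monoD[OF h_mono, of r s] by (auto simp: S_def)
    qed
    have "measure M {\<omega> \<in> space M. t < h (Y \<omega>)} \<le> measure M {\<omega> \<in> space M. a \<le> Y \<omega>}"
      using Y_nonneg S(2)
      by (intro M.finite_measure_mono) (auto simp: a_def S_def intro!: cInf_lower)
    also have "\<dots> \<le> C * measure N {\<omega> \<in> space N. a < X \<omega>}"
      using \<open>0 \<le> a\<close> by (rule tail)
    also have "\<dots> \<le> C * measure N {\<omega> \<in> space N. t < h (X \<omega>)}"
      using C above by (intro mult_left_mono N.finite_measure_mono) auto
    finally show ?thesis
      using C by (simp add: M.emeasure_eq_measure N.emeasure_eq_measure flip: ennreal_mult)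
  qed
  have "(\<integral>\<^sup>+ \<omega>. ennreal (h (Y \<omega>)) \<partial>M) =
      (\<integral>\<^sup>+ t. indicator {0..} t * emeasure M {\<omega> \<in> space M. t < h (Y \<omega>)} \<partial>lborel)"
    using h_nonneg by (intro nn_integral_eq_integral_tail) (auto intro: M.sigma_finite_measure_axioms)
  also have "\<dots> \<le> (\<integral>\<^sup>+ t. ennreal C *
      (indicator {0..} t * emeasure N {\<omega> \<in> space N. t < h (X \<omega>)}) \<partial>lborel)"
    using superlevel by (intro nn_integral_mono) (auto simp: indicator_def)
  also have "\<dots> = ennreal C *
      (\<integral>\<^sup>+ t. indicator {0..} t * emeasure N {\<omega> \<in> space N. t < h (X \<omega>)} \<partial>lborel)"
    by (intro nn_integral_cmult) measurable
  also have "\<dots> = ennreal C * (\<integral>\<^sup>+ \<omega>. ennreal (h (X \<omega>)) \<partial>N)"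
    using h_nonneg
    by (subst nn_integral_eq_integral_tail) (auto intro: N.sigma_finite_measure_axioms)
  finally have "(\<integral>\<^sup>+ \<omega>. ennreal (h (Y \<omega>)) \<partial>M) \<le> ennreal C * (\<integral>\<^sup>+ \<omega>. ennreal (h (X \<omega>)) \<partial>N)" .
  moreover have "integrable M (\<lambda>\<omega>. h (Y \<omega>))"
    using h_nonneg h_bound by (intro M.integrable_const_bound[of _ B]) auto
  moreover have "integrable N (\<lambda>\<omega>. h (X \<omega>))"
    using h_nonneg h_bound by (intro N.integrable_const_bound[of _ B]) auto
  ultimately show ?thesis
    using C h_nonneg by (simp add: nn_integral_eq_integral flip: ennreal_mult)
qed

section \<open>The local modulus of a bounded function\<close>

lemma local_modulus_upper:
  assumes "\<And>y. y \<in> I \<Longrightarrow> \<bar>g y\<bar> \<le> K" "x \<in> I" "x + u \<in> I" "\<bar>u\<bar> \<le> \<theta>"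
  shows "\<bar>g (x + u) - g x\<bar> \<le> local_modulus I x g \<theta>"
  unfolding local_modulus_def
proof (rule cSup_upper)
  show "bdd_above {\<bar>g (x + u) - g x\<bar> |u. x + u \<in> I \<and> \<bar>u\<bar> \<le> \<theta>}"
  proof (rule bdd_aboveI[of _ "2 * K"])
    fix r assume "r \<in> {\<bar>g (x + u) - g x\<bar> |u. x + u \<in> I \<and> \<bar>u\<bar> \<le> \<theta>}"
    then show "r \<le> 2 * K"
      using assms(1)[OF assms(2)] assms(1) by (force simp: abs_le_iff)
  qed
qed (use assms in auto)

lemma local_modulus_least:
  assumes "x \<in> I" "0 \<le> \<theta>" "\<And>u. x + u \<in> I \<Longrightarrow> \<bar>u\<bar> \<le> \<theta> \<Longrightarrow> \<bar>g (x + u) - g x\<bar> \<le> r"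
  shows "local_modulus I x g \<theta> \<le> r"
  unfolding local_modulus_def
proof (rule cSup_least)
  show "{\<bar>g (x + u) - g x\<bar> |u. x + u \<in> I \<and> \<bar>u\<bar> \<le> \<theta>} \<noteq> {}"
    using assms(1,2) by (auto intro!: exI[of _ 0])
qed (use assms in auto)

text \<open>
  The supremum over the empty set, which defines the modulus at a negative argument, need not be
  compatible with monotonicity. Extending the modulus by its value at \<open>0\<close> gives a function
  that is nondecreasing on the whole line.
\<close>

lemma
  assumes K: "\<And>y. y \<in> I \<Longrightarrow> \<bar>g y\<bar> \<le> K" and x: "x \<in> I"
  shows mono_local_modulus_max: "mono (\<lambda>\<theta>. local_modulus I x g (max 0 \<theta>))"
    and local_modulus_max_nonneg: "0 \<le> local_modulus I x g (max 0 \<theta>)"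
    and local_modulus_max_le: "local_modulus I x g (max 0 \<theta>) \<le> 2 * K"
proof -
  show "mono (\<lambda>\<theta>. local_modulus I x g (max 0 \<theta>))"
    by (intro monoI local_modulus_least local_modulus_upper[OF K] x) auto
  show "0 \<le> local_modulus I x g (max 0 \<theta>)"
    using local_modulus_upper[where g = g and \<theta> = "max 0 \<theta>" and u = 0, OF K x] x by simp
  show "local_modulus I x g (max 0 \<theta>) \<le> 2 * K"
    using K[OF x] K by (intro local_modulus_least x) (force simp: abs_le_iff)+
qed

lemma borel_measurable_local_modulus:
  assumes "\<And>y. y \<in> I \<Longrightarrow> \<bar>g y\<bar> \<le> K" "x \<in> I"
  shows "local_modulus I x g \<in> borel_measurable borel"
proof -
  have [measurable]: "(\<lambda>\<theta>. local_modulus I x g (max 0 \<theta>)) \<in> borel_measurable borel"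
    using assms by (intro borel_measurable_mono mono_local_modulus_max)
  have "local_modulus I x g =
      (\<lambda>\<theta>. if \<theta> < 0 then Sup {} else local_modulus I x g (max 0 \<theta>))"
    by (auto simp: fun_eq_iff local_modulus_def max_def intro!: arg_cong[of _ _ Sup])
  also have "\<dots> \<in> borel_measurable borel"
    by measurable
  finally show ?thesis .
qed

section \<open>The bound for functions with one-sided limits\<close>

text \<open>
  The part of the error due to the oscillation of \<open>g\<close> near \<open>x\<close>: the tail comparison is applied to
  \<open>\<bar>Z\<bar>\<close> and \<open>X\<close>, with the scaling \<open>1 / c\<close> absorbed into the nondecreasing function.
\<close>

lemma integral_le_exponential_local_modulus:
  fixes g :: "real \<Rightarrow> real" and Z :: "'a \<Rightarrow> real" and X :: "'b \<Rightarrow> real"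
  assumes "prob_space M" "prob_space N"
    and [measurable]: "Z \<in> borel_measurable M"
    and g_meas: "(\<lambda>\<omega>. g (x + Z \<omega> / c)) \<in> borel_measurable M"
    and range: "\<And>\<omega>. \<omega> \<in> space M \<Longrightarrow> x + Z \<omega> / c \<in> I"
    and "0 < c" "0 < \<beta>" "0 \<le> C"
    and tail: "\<And>\<theta>. 0 \<le> \<theta> \<Longrightarrow>
      measure M {\<omega> \<in> space M. \<bar>Z \<omega>\<bar> \<ge> \<theta>} \<le> C * exp (- \<beta> * \<theta>)"
    and X_exp: "distributed N lborel X (exponential_density \<beta>)"
    and K: "\<And>y. y \<in> I \<Longrightarrow> \<bar>g y\<bar> \<le> K" and x: "x \<in> I" and gx: "g x = 0"
  shows "\<bar>\<integral>\<omega>. g (x + Z \<omega> / c) \<partial>M\<bar> \<le> C * (\<integral>\<omega>. local_modulus I x g (X \<omega> / c) \<partial>N)"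
proof -
  interpret M: prob_space M by fact
  interpret N: prob_space N by fact
  have [measurable]: "X \<in> borel_measurable N"
    using distributed_measurable[OF X_exp] by simp
  define h where "h = (\<lambda>s. local_modulus I x g (max 0 (s / c)))"
  have "mono h"
    using monoD[OF mono_local_modulus_max[of I g, OF K x]] \<open>0 < c\<close>
    unfolding h_def by (intro monoI) (simp add: divide_right_mono)
  have h_meas [measurable]: "h \<in> borel_measurable borel"
    using \<open>mono h\<close> by (rule borel_measurable_mono)
  have h_nonneg: "0 \<le> h s" and h_le: "h s \<le> 2 * K" for s
    using local_modulus_max_nonneg[of I g, OF K x] local_modulus_max_le[of I g, OF K x]
    by (auto simp: h_def)
  have [measurable]: "local_modulus I x g \<in> borel_measurable borel"
    using K x by (rule borel_measurable_local_modulus)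
  have "\<bar>\<integral>\<omega>. g (x + Z \<omega> / c) \<partial>M\<bar> \<le> (\<integral>\<omega>. \<bar>g (x + Z \<omega> / c)\<bar> \<partial>M)"
    by (rule integral_abs_bound)
  also have "\<dots> \<le> (\<integral>\<omega>. h \<bar>Z \<omega>\<bar> \<partial>M)"
  proof (rule integral_mono)
    show "integrable M (\<lambda>\<omega>. \<bar>g (x + Z \<omega> / c)\<bar>)"
      using g_meas K range by (intro M.integrable_const_bound[of _ K]) auto
    show "integrable M (\<lambda>\<omega>. h \<bar>Z \<omega>\<bar>)"
      using h_nonneg h_le by (intro M.integrable_const_bound[of _ "2 * K"]) auto
    show "\<bar>g (x + Z \<omega> / c)\<bar> \<le> h \<bar>Z \<omega>\<bar>" if "\<omega> \<in> space M" for \<omega>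
      using local_modulus_upper[where g = g and u = "Z \<omega> / c" and \<theta> = "max 0 (\<bar>Z \<omega>\<bar> / c)",
          OF K x range[OF that]] \<open>0 < c\<close>
      by (simp add: h_def gx)
  qed
  also have "\<dots> \<le> C * (\<integral>\<omega>. h (X \<omega>) \<partial>N)"
  proof (rule integral_mono_le_of_tail_le[where h = h and Y = "\<lambda>\<omega>. \<bar>Z \<omega>\<bar>" and X = X,
        OF \<open>prob_space M\<close> \<open>prob_space N\<close>])
    fix a :: real assume "0 \<le> a"
    then show "measure M {\<omega> \<in> space M. a \<le> \<bar>Z \<omega>\<bar>} \<le> C * measure N {\<omega> \<in> space N. a < X \<omega>}"
      using tail[of a] N.exponential_distributedD_gt[OF X_exp _ \<open>0 < \<beta>\<close>, of a]
      by (simp add: mult.commute)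
  qed (use \<open>mono h\<close> h_nonneg h_le \<open>0 \<le> C\<close> in auto)
  also have "(\<integral>\<omega>. h (X \<omega>) \<partial>N) = (\<integral>\<omega>. local_modulus I x g (X \<omega> / c) \<partial>N)"
  proof (rule integral_cong_AE)
    have "AE \<omega> in N. 0 < X \<omega>"
      using N.exponential_distributedD_gt[OF X_exp order_refl \<open>0 < \<beta>\<close>]
      by (intro iffD1[OF N.prob_Collect_eq_1]) auto
    then show "AE \<omega> in N. h (X \<omega>) = local_modulus I x g (X \<omega> / c)"
      using \<open>0 < c\<close> by (auto simp: h_def max_def)
  qed auto
  finally show ?thesis .
qed

lemma assoc_fun_bounded:
  assumes "bounded (f ` I)"
  obtains K where "\<And>y. y \<in> I \<Longrightarrow> \<bar>assoc_fun I f x y\<bar> \<le> K"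
proof -
  obtain B where "\<And>y. y \<in> I \<Longrightarrow> \<bar>f y\<bar> \<le> B"
    using assms by (auto simp: bounded_iff)
  then have "\<bar>assoc_fun I f x y\<bar> \<le> B + \<bar>right_limit f x\<bar> + \<bar>left_limit f x\<bar>" if "y \<in> I" for y
    using that by (force simp: assoc_fun_def indicator_def)
  then show ?thesis by (rule that)
qed

theorem theorem3p3:
  fixes I :: "real set" and x :: real and f g :: "real \<Rightarrow> real"
    and M :: "nat \<Rightarrow> 'a measure" and Z :: "nat \<Rightarrow> 'a \<Rightarrow> real"
    and N :: "'b measure" and X :: "'b \<Rightarrow> real"
    and \<beta> p q :: real and C :: "nat \<Rightarrow> real \<Rightarrow> real"
  assumes interval: "is_interval I"
    and x_interior: "x \<in> interior I"
    and prob: "\<And>n. n \<ge> 1 \<Longrightarrow> prob_space (M n)"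
    and rv: "\<And>n. n \<ge> 1 \<Longrightarrow> Z n \<in> borel_measurable (M n)"
    and range: "\<And>n \<omega>. n \<ge> 1 \<Longrightarrow> \<omega> \<in> space (M n) \<Longrightarrow> x + Z n \<omega> / sqrt (real n) \<in> I"
    and beta_pos: "\<beta> > 0"
    and C_pos: "\<And>n. n \<ge> 1 \<Longrightarrow> C n \<beta> > 0"
    and tail: "\<And>n \<theta>. n \<ge> 1 \<Longrightarrow> \<theta> \<ge> 0 \<Longrightarrow>
       measure (M n) {\<omega> \<in> space (M n). \<bar>Z n \<omega>\<bar> \<ge> \<theta>} \<le> C n \<beta> * exp (- \<beta> * \<theta>)"
    and N_prob: "prob_space N"
    and X_exp: "distributed N lborel X (exponential_density \<beta>)"
    and f: "f \<in> B_space I x"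
    and g: "g = assoc_fun I f x"
    and p: "(\<lambda>n. measure (M n) {\<omega> \<in> space (M n). Z n \<omega> > 0}) \<longlonglongrightarrow> p"
    and q: "(\<lambda>n. measure (M n) {\<omega> \<in> space (M n). Z n \<omega> < 0}) \<longlonglongrightarrow> q"
    and pq: "p + q = 1"
    and p_ne_half: "p \<noteq> 1 / 2"
  shows "\<forall>n\<ge>1.
    \<bar>L_op M Z n f x - (right_limit f x * p + left_limit f x * q)\<bar>
    \<le> \<bar>right_limit f x - f x\<bar> * \<bar>measure (M n) {\<omega> \<in> space (M n). Z n \<omega> > 0} - p\<bar>
      + \<bar>left_limit f x - f x\<bar> * \<bar>measure (M n) {\<omega> \<in> space (M n). Z n \<omega> < 0} - q\<bar>
      + C n \<beta> * (\<integral>\<omega>. local_modulus I x g (X \<omega> / sqrt (real n)) \<partial>N)"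
proof (intro allI impI)
  fix n :: nat assume n: "n \<ge> 1"
  interpret prob_space "M n" using prob[OF n] .
  let ?Y = "\<lambda>\<omega>. x + Z n \<omega> / sqrt (real n)"
  let ?r = "right_limit f x" and ?l = "left_limit f x"
  define A where "A = {\<omega> \<in> space (M n). Z n \<omega> > 0}"
  define B where "B = {\<omega> \<in> space (M n). Z n \<omega> < 0}"
  note rv[OF n, measurable]
  have [measurable]: "A \<in> events" "B \<in> events"
    unfolding A_def B_def by measurable
  have x: "x \<in> I"
    using x_interior interior_subset by blast
  have sqrt_pos: "0 < sqrt (real n)"
    using n by simp
  have bounded: "bounded (f ` I)" and f_meas: "f \<in> borel_measurable (restrict_space borel I)"
    using f by (auto simp: B_space_def)
  obtain K where K: "\<bar>g y\<bar> \<le> K" if "y \<in> I" for y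
    unfolding g using assoc_fun_bounded[OF bounded] by metis
  have gx: "g x = 0"
    by (simp add: g assoc_fun_def)
  have f_eq: "f (?Y \<omega>) = g (?Y \<omega>) + (f x + (?r - f x) * indicator A \<omega> + (?l - f x) * indicator B \<omega>)"
    if "\<omega> \<in> space (M n)" for \<omega>
    using that range[OF n that] sqrt_pos
    by (cases "Z n \<omega>" "0 :: real" rule: linorder_cases)
      (auto simp: g assoc_fun_def indicator_def A_def B_def zero_less_divide_iff divide_less_0_iff)
  have fY_meas: "(\<lambda>\<omega>. f (?Y \<omega>)) \<in> borel_measurable (M n)"
    using range[OF n]
    by (intro measurable_compose[OF measurable_restrict_space2 f_meas]) auto
  have "(\<lambda>\<omega>. f (?Y \<omega>) - (f x + (?r - f x) * indicator A \<omega> + (?l - f x) * indicator B \<omega>))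
      \<in> borel_measurable (M n)"
    using fY_meas by measurable
  then have gY_meas: "(\<lambda>\<omega>. g (?Y \<omega>)) \<in> borel_measurable (M n)"
    by (rule subst[OF measurable_cong, rotated]) (simp add: f_eq)
  have gY_int: "integrable (M n) (\<lambda>\<omega>. g (?Y \<omega>))"
    using gY_meas K range[OF n] by (intro integrable_const_bound[of _ K]) auto
  have "L_op M Z n f x = (\<integral>\<omega>. g (?Y \<omega>) +
      (f x + (?r - f x) * indicator A \<omega> + (?l - f x) * indicator B \<omega>) \<partial>M n)"
    unfolding L_op_def by (rule Bochner_Integration.integral_cong) (auto simp: f_eq)
  also have "\<dots> = (\<integral>\<omega>. g (?Y \<omega>) \<partial>M n) + (f x + (?r - f x) * prob A + (?l - f x) * prob B)"
    using gY_int by (simp add: prob_space less_top[symmetric])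
  finally have L: "L_op M Z n f x =
      (\<integral>\<omega>. g (?Y \<omega>) \<partial>M n) + (f x + (?r - f x) * prob A + (?l - f x) * prob B)" .
  \<comment> \<open>Here \<open>p + q = 1\<close> enters, to split \<open>f(x) = f(x) p + f(x) q\<close>.\<close>
  have "L_op M Z n f x - (?r * p + ?l * q) - (\<integral>\<omega>. g (?Y \<omega>) \<partial>M n)
      = (?r - f x) * (prob A - p) + (?l - f x) * (prob B - q)"
    using arg_cong[OF pq, of "\<lambda>s. f x * s"] unfolding L by (simp add: algebra_simps)
  then have "\<bar>L_op M Z n f x - (?r * p + ?l * q)\<bar>
      \<le> \<bar>?r - f x\<bar> * \<bar>prob A - p\<bar> + \<bar>?l - f x\<bar> * \<bar>prob B - q\<bar> + \<bar>\<integral>\<omega>. g (?Y \<omega>) \<partial>M n\<bar>"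
    unfolding abs_mult[symmetric] by linarith
  moreover have "\<bar>\<integral>\<omega>. g (?Y \<omega>) \<partial>M n\<bar>
      \<le> C n \<beta> * (\<integral>\<omega>. local_modulus I x g (X \<omega> / sqrt (real n)) \<partial>N)"
    using C_pos[OF n] tail[OF n] range[OF n] K
    by (intro integral_le_exponential_local_modulus[OF prob[OF n] N_prob rv[OF n] gY_meas _
          sqrt_pos beta_pos _ _ X_exp _ x gx]) auto
  ultimately show "\<bar>L_op M Z n f x - (?r * p + ?l * q)\<bar>
      \<le> \<bar>?r - f x\<bar> * \<bar>measure (M n) {\<omega> \<in> space (M n). Z n \<omega> > 0} - p\<bar>
        + \<bar>?l - f x\<bar> * \<bar>measure (M n) {\<omega> \<in> space (M n). Z n \<omega> < 0} - q\<bar>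
        + C n \<beta> * (\<integral>\<omega>. local_modulus I x g (X \<omega> / sqrt (real n)) \<partial>N)"
    unfolding A_def B_def by linarith
qed

end
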